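(* Let $f$ be a tensor field on a finite 6-D point cloud with components of degrees $(1,1)$, $(1,0)$, $(0,1)$, let $\Phi_P$ be the projection to $SE(3)$ defined in the context, and let $s(f)$ be the swapped field. Assume that the singular values $\sigma_1\ge\sigma_2\ge\sigma_3\ge0$ of the matrix $\hat r(f)$ satisfy $\sigma_2>\sigma_3$. Then $$\Phi_P(s(f))=(\Phi_P(f))^{-1}.$$
   Context: **Field.** $f$ is a finite indexed family of points $z_u=\tilde x_u\oplus\tilde y_u\in\mathbb{R}^6$ ($\tilde x_u,\tilde y_u\in\mathbb{R}^3$, $u=1,\dots,L$), with features $f_u^{1,1}\in\mathbb{R}^9$, $f_u^{1,0}\in\mathbb{R}^3$, $f_u^{0,1}\in\mathbb{R}^3$ attached to $z_u$. A degree-$(p,q)$ feature, a vector in $\mathbb{R}^{2p+1}\otimes\mathbb{R}^{2q+1}$, is also regarded as a $(2p+1)\times(2q+1)$ matrix. **Swap.** $s$ is the nontrivial element of $\mathbb{Z}/2\mathbb{Z}$. On points, $s(z^1\oplus z^2)=z^2\oplus z^1$. On fields, $(s(f))^{p,q}(z)=\bigl(f^{q,p}(s(z))\bigr)^T$; that is, $s(f)$ is supported on the points $s(z_u)$, where its degree-$(p,q)$ feature is the transpose of $f^{q,p}_u$. **Projection $\Phi_P$.** Let $\boldsymbol m(\tilde X)$ and $\boldsymbol m(\tilde Y)$ be the means of the first and of the last three coordinates of the points $z_u$ of the field. Let $\mathrm{Pool}_u$ denote the average over $u$, and $\tilde r=\mathrm{Pool}_u(f_u^{1,1})$, $t_X=\mathrm{Pool}_u(f_u^{1,0})$,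 $t_Y=\mathrm{Pool}_u(f_u^{0,1})$. Let $\hat r=\mathrm{unvec}(\tilde r)\in\mathbb{R}^{3\times3}$ ($\mathrm{unvec}$ is the inverse of stacking columns). Then $\Phi_P(f)=(r,t)\in SE(3)$ with $$r=\mathrm{SVD}(\hat r),\qquad t=(\boldsymbol m(\tilde Y)+t_Y)-r(\boldsymbol m(\tilde X)+t_X).$$ **SVD projection.** If $A=\hat U\hat\Sigma\hat V^T$ is a singular value decomposition with $\hat U,\hat V\in O(3)$, $\hat\Sigma=\mathrm{diag}(\sigma_1,\sigma_2,\sigma_3)$, $\sigma_1\ge\sigma_2\ge\sigma_3\ge0$, then $\mathrm{SVD}(A)=\hat U\,\mathrm{diag}(1,1,\mathrm{sign}\det(\hat U\hat V^T))\,\hat V^T\in SO(3)$; this does not depend on the chosen decomposition when $\sigma_2>\sigma_3$. $(r,t)\in SE(3)$ is the map $x\mapsto rx+t$, so $(r,t)^{-1}=(r^T,-r^Tt)$. *)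

theory Defs
  imports "HOL-Analysis.Analysis" "HOL-Algebra.Group"
begin

section \<open>The group \<open>SE(3)\<close>\<close>

text \<open>The pair \<open>(r, t)\<close> stands for the map \<open>x \<mapsto> r x + t\<close>.\<close>

definition se3_map :: "(real^3^3) \<times> (real^3) \<Rightarrow> real^3 \<Rightarrow> real^3" where
  "se3_map g x = fst g *v x + snd g"

definition SE3 :: "((real^3^3) \<times> (real^3)) monoid" where
  "SE3 = \<lparr>carrier = {g. rotation_matrix (fst g)},
          mult = (\<lambda>g h. (fst g ** fst h, fst g *v snd h + snd g)),
          one = (mat 1, 0)\<rparr>"

lemma se3_map_mult: "se3_map (g \<otimes>\<^bsub>SE3\<^esub> h) = se3_map g \<circ> se3_map h"
  by (rule ext) (simp add: se3_map_def SE3_def matrix_vector_mul_assoc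
      matrix_vector_right_distrib add.assoc)

lemma se3_map_one: "se3_map \<one>\<^bsub>SE3\<^esub> = id"
  by (rule ext) (simp add: se3_map_def SE3_def)

lemma SE3_left_inverse:
  assumes "(r, t) \<in> carrier SE3"
  shows "(transpose r, - (transpose r *v t)) \<in> carrier SE3"
    and "(transpose r, - (transpose r *v t)) \<otimes>\<^bsub>SE3\<^esub> (r, t) = \<one>\<^bsub>SE3\<^esub>"
  using assms by (auto simp: SE3_def rotation_matrix_def orthogonal_matrix_def)

lemma group_SE3: "group SE3"
proof (rule groupI)
  fix g h assume "g \<in> carrier SE3" "h \<in> carrier SE3"
  then show "g \<otimes>\<^bsub>SE3\<^esub> h \<in> carrier SE3"
    by (simp add: SE3_def rotation_matrix_def orthogonal_matrix_mul det_mul)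
next
  show "\<one>\<^bsub>SE3\<^esub> \<in> carrier SE3"
    by (simp add: SE3_def rotation_matrix_def orthogonal_matrix_id)
next
  fix g h k
  show "g \<otimes>\<^bsub>SE3\<^esub> h \<otimes>\<^bsub>SE3\<^esub> k = g \<otimes>\<^bsub>SE3\<^esub> (h \<otimes>\<^bsub>SE3\<^esub> k)"
    by (simp add: SE3_def matrix_mul_assoc matrix_vector_mul_assoc
        matrix_vector_right_distrib add.assoc)
next
  fix g :: "(real^3^3) \<times> (real^3)"
  show "\<one>\<^bsub>SE3\<^esub> \<otimes>\<^bsub>SE3\<^esub> g = g"
    by (simp add: SE3_def)
next
  fix g assume "g \<in> carrier SE3"
  then show "\<exists>h\<in>carrier SE3. h \<otimes>\<^bsub>SE3\<^esub> g = \<one>\<^bsub>SE3\<^esub>"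
    using SE3_left_inverse by (metis surj_pair)
qed

lemma inv_SE3:
  assumes "(r, t) \<in> carrier SE3"
  shows "inv\<^bsub>SE3\<^esub> (r, t) = (transpose r, - (transpose r *v t))"
  using group.inv_equality[OF group_SE3] SE3_left_inverse[OF assms] assms by blast

section \<open>Singular value decomposition\<close>

definition diag :: "real^'n \<Rightarrow> real^'n^'n" where
  "diag d = (\<chi> i j. if i = j then d $ i else 0)"

definition is_SVD :: "real^3^3 \<Rightarrow> real^3^3 \<Rightarrow> real^3 \<Rightarrow> real^3^3 \<Rightarrow> bool" where
  "is_SVD A U \<sigma> V \<longleftrightarrow>
     orthogonal_matrix U \<and> orthogonal_matrix V \<and>
     \<sigma> $ 1 \<ge> \<sigma> $ 2 \<and> \<sigma> $ 2 \<ge> \<sigma> $ 3 \<and> \<sigma> $ 3 \<ge> 0 \<and>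
     A = U ** diag \<sigma> ** transpose V"

text \<open>\<open>\<sigma>\<close> is the list, in decreasing order and with multiplicity, of the singular values of \<open>A\<close>.\<close>

definition has_singular_values :: "real^3^3 \<Rightarrow> real^3 \<Rightarrow> bool" where
  "has_singular_values A \<sigma> \<longleftrightarrow> (\<exists>U V. is_SVD A U \<sigma> V)"

text \<open>An arbitrary decomposition is chosen; the value depends on that choice only when the
  last two singular values of \<open>A\<close> coincide.\<close>

definition SVD_proj :: "real^3^3 \<Rightarrow> real^3^3" where
  "SVD_proj A = (SOME R. \<exists>U \<sigma> V. is_SVD A U \<sigma> V \<and>
     R = U ** diag (vector [1, 1, sgn (det (U ** transpose V))]) ** transpose V)"

lemma rotation_matrix_SVD_proj:
  assumes "has_singular_values A \<sigma>"
  shows "rotation_matrix (SVD_proj A)"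
proof -
  have "\<exists>R U \<sigma> V. is_SVD A U \<sigma> V \<and>
     R = U ** diag (vector [1, 1, sgn (det (U ** transpose V))]) ** transpose V"
    using assms unfolding has_singular_values_def by blast
  from someI_ex[OF this, folded SVD_proj_def]
  obtain U \<sigma> V where svd: "is_SVD A U \<sigma> V"
    and R: "SVD_proj A = U ** diag (vector [1, 1, sgn (det (U ** transpose V))]) ** transpose V"
    by blast
  define e where "e = sgn (det (U ** transpose V))"
  have orth: "orthogonal_matrix U" "orthogonal_matrix V"
    using svd by (auto simp: is_SVD_def)
  have dets: "det U = 1 \<or> det U = -1" "det V = 1 \<or> det V = -1"
    using orth det_orthogonal_matrix by blast+
  have e: "e = det U * det V"
    using dets by (auto simp: e_def det_mul)
  have ee: "e * e = 1"
    using dets e by auto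
  have D: "orthogonal_matrix (diag (vector [1, 1, e] :: real^3))"
    unfolding orthogonal_matrix vec_eq_iff forall_3
    using ee by (simp add: diag_def transpose_def matrix_matrix_mult_def mat_def sum_3)
  have "det (diag (vector [1, 1, e] :: real^3)) = e"
    by (simp add: diag_def det_3)
  then have "det (SVD_proj A) = 1"
    using dets e unfolding R e_def[symmetric] by (auto simp: det_mul)
  moreover have "orthogonal_matrix (SVD_proj A)"
    unfolding R e_def[symmetric] by (intro orthogonal_matrix_mul D orth) (simp add: orth)
  ultimately show ?thesis by (simp add: rotation_matrix_def)
qed

section \<open>Tensor fields on a 6-D point cloud\<close>

definition stack_columns :: "real^3^3 \<Rightarrow> real^9" where
  "stack_columns A = vector
     [A$1$1, A$2$1, A$3$1,
      A$1$2, A$2$2, A$3$2,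
      A$1$3, A$2$3, A$3$3]"

definition unvec :: "real^9 \<Rightarrow> real^3^3" where
  "unvec = inv_into UNIV stack_columns"

lemma stack_columns_nth:
  "stack_columns A $ 1 = A$1$1" "stack_columns A $ 2 = A$2$1" "stack_columns A $ 3 = A$3$1"
  "stack_columns A $ 4 = A$1$2" "stack_columns A $ 5 = A$2$2" "stack_columns A $ 6 = A$3$2"
  "stack_columns A $ 7 = A$1$3" "stack_columns A $ 8 = A$2$3" "stack_columns A $ 9 = A$3$3"
  unfolding stack_columns_def vector_def by simp_all

lemma exhaust_9:
  fixes x :: 9
  shows "x = 1 \<or> x = 2 \<or> x = 3 \<or> x = 4 \<or> x = 5 \<or> x = 6 \<or> x = 7 \<or> x = 8 \<or> x = 9"
proof (induct x)
  case (of_int z)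
  then have "z = 0 \<or> z = 1 \<or> z = 2 \<or> z = 3 \<or> z = 4 \<or> z = 5 \<or> z = 6 \<or> z = 7 \<or> z = 8"
    by fastforce
  then show ?case by auto
qed

lemma bij_stack_columns: "bij stack_columns"
proof (rule bijI)
  show "inj stack_columns"
  proof (rule injI)
    fix A B assume "stack_columns A = stack_columns B"
    then have "stack_columns A $ i = stack_columns B $ i" for i by simp
    from this[of 1] this[of 2] this[of 3] this[of 4] this[of 5] this[of 6]
      this[of 7] this[of 8] this[of 9]
    show "A = B" by (simp only: stack_columns_nth) (simp add: vec_eq_iff forall_3)
  qed
  show "surj stack_columns"
  proof (rule surjI)
    fix v :: "real^9"
    show "stack_columns (vector [vector [v$1, v$4, v$7], vector [v$2, v$5, v$8],
            vector [v$3, v$6, v$9]]) = v" (is "stack_columns ?A = v")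
    proof (rule vec_eq_iff[THEN iffD2], rule allI)
      fix i :: 9
      show "stack_columns ?A $ i = v $ i"
        using exhaust_9[of i] by (elim disjE; hypsubst; simp only: stack_columns_nth vector_3)
    qed
  qed
qed

lemma unvec_stack_columns [simp]: "unvec (stack_columns A) = A"
  by (simp add: unvec_def bij_is_inj[OF bij_stack_columns])

lemma stack_columns_unvec [simp]: "stack_columns (unvec v) = v"
  by (simp add: unvec_def surj_f_inv_f bij_is_surj[OF bij_stack_columns])

text \<open>A point of \<open>\<real>\<^sup>6 = \<real>\<^sup>3 \<oplus> \<real>\<^sup>3\<close> is a pair. The index type \<open>'l\<close> plays the role of
  \<open>{1, \<dots>, L}\<close>; it is required to be finite from the pooling operation on.
  The matrix of a feature is \<^term>\<open>unvec\<close> of it in degree \<open>(1,1)\<close>, the \<open>3 \<times> 1\<close> matrix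
  \<^const>\<open>columnvector\<close> in degree \<open>(1,0)\<close> and the \<open>1 \<times> 3\<close> matrix \<^const>\<open>rowvector\<close> in
  degree \<open>(0,1)\<close>.\<close>

record 'l tensor_field =
  point :: "'l \<Rightarrow> (real^3) \<times> (real^3)"
  feat11 :: "'l \<Rightarrow> real^9"
  feat10 :: "'l \<Rightarrow> real^3"
  feat01 :: "'l \<Rightarrow> real^3"

definition swap_field :: "'l tensor_field \<Rightarrow> 'l tensor_field" where
  "swap_field f =
    \<lparr>point = (\<lambda>u. (snd (point f u), fst (point f u))),
     feat11 = (\<lambda>u. stack_columns (transpose (unvec (feat11 f u)))),
     feat10 = (\<lambda>u. column 1 (transpose (rowvector (feat01 f u) :: real^3^1))),
     feat01 = (\<lambda>u. row 1 (transpose (columnvector (feat10 f u) :: real^1^3)))\<rparr>"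

definition pool :: "('l::finite \<Rightarrow> 'v) \<Rightarrow> 'v::real_vector" where
  "pool g = (\<Sum>u\<in>UNIV. g u) /\<^sub>R real CARD('l)"

definition r_hat :: "'l::finite tensor_field \<Rightarrow> real^3^3" where
  "r_hat f = unvec (pool (feat11 f))"

definition Phi_P :: "'l::finite tensor_field \<Rightarrow> (real^3^3) \<times> (real^3)" where
  "Phi_P f =
    (let r = SVD_proj (r_hat f);
         mX = pool (\<lambda>u. fst (point f u));
         mY = pool (\<lambda>u. snd (point f u));
         tX = pool (feat10 f);
         tY = pool (feat01 f)
     in (r, (mY + tY) - r *v (mX + tX)))"

lemma Phi_P_in_SE3:
  assumes "has_singular_values (r_hat f) \<sigma>"
  shows "Phi_P f \<in> carrier SE3"
  using rotation_matrix_SVD_proj[OF assms] by (simp add: Phi_P_def SE3_def Let_def)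

end

theory Submission
  imports Defs
begin

text \<open>Among all rotations \<open>Q\<close>, the matrix \<open>U diag(1, 1, sgn det(U V\<^sup>T)) V\<^sup>T\<close> maximizes
  \<open>tr (Q\<^sup>T A)\<close>, and it is the only maximizer when \<open>\<sigma>\<^sub>2 > \<sigma>\<^sub>3\<close>. This property does not mention the
  decomposition, so two decompositions give the same projection without any appeal to the
  uniqueness of the singular values. Since \<open>V \<Sigma> U\<^sup>T\<close> decomposes \<open>A\<^sup>T\<close>, the projection then commutes
  with transposition, and the swap transposes \<open>r_hat\<close> and exchanges the two centred means.\<close>

section \<open>Entries and traces of orthogonal matrices\<close>

lemma orthogonal_matrix_entry_le_1:
  fixes W :: "real^'n^'n"
  assumes "orthogonal_matrix W"
  shows "W $ i $ j \<le> 1"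
proof -
  have "norm (row i W) = 1"
    using assms by (simp add: orthogonal_matrix_orthonormal_rows)
  then show ?thesis
    using component_le_norm_cart[of "row i W" j] by (simp add: row_def)
qed

text \<open>The entry 1 already exhausts the unit norm of its row. The column follows from the same
  argument for the transpose.\<close>

lemma orthogonal_matrix_entry_eq_1:
  fixes W :: "real^'n^'n"
  assumes W: "orthogonal_matrix W" and 1: "W $ i $ i = 1" and "j \<noteq> i"
  shows "W $ i $ j = 0" "W $ j $ i = 0"
proof -
  have zero: "M $ i $ j = 0" if M: "orthogonal_matrix M" "M $ i $ i = 1" for M :: "real^'n^'n"
  proof -
    have "norm (row i M) = 1"
      using M by (simp add: orthogonal_matrix_orthonormal_rows)
    then have "(\<Sum>k\<in>UNIV. (M $ i $ k)\<^sup>2) = 1"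
      by (simp add: norm_eq_1 inner_vec_def row_def power2_eq_square)
    moreover have "(\<Sum>k\<in>UNIV. (M $ i $ k)\<^sup>2) = 1 + (\<Sum>k\<in>UNIV - {i}. (M $ i $ k)\<^sup>2)"
      using M(2) by (simp add: sum.remove[of UNIV i])
    ultimately have "(\<Sum>k\<in>UNIV - {i}. (M $ i $ k)\<^sup>2) = 0" by simp
    then have "\<forall>k\<in>UNIV - {i}. (M $ i $ k)\<^sup>2 = 0"
      by (subst (asm) sum_nonneg_eq_0_iff) auto
    then show ?thesis using \<open>j \<noteq> i\<close> by simp
  qed
  show "W $ i $ j = 0" by (rule zero[OF W 1])
  show "W $ j $ i = 0"
    using zero[of "transpose W"] W 1 by (simp add: transpose_def orthogonal_matrix_transpose[unfolded transpose_def])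
qed

text \<open>For determinant 1 the entrywise bound suffices. For determinant -1, \<open>- W\<close>
  is a rotation of 3-space, and its trace is at least -1.\<close>

lemma orthogonal_matrix_trace_le:
  fixes W :: "real^3^3"
  assumes W: "orthogonal_matrix W"
  shows "trace W \<le> 2 + det W"
proof (cases "det W = 1")
  case True
  then show ?thesis
    using orthogonal_matrix_entry_le_1[OF W, of 1 1] orthogonal_matrix_entry_le_1[OF W, of 2 2]
      orthogonal_matrix_entry_le_1[OF W, of 3 3]
    by (simp add: trace_def sum_3)
next
  case False
  then have d: "det W = - 1" using det_orthogonal_matrix[OF W] by blast
  have rows: "norm (row i W) = 1" for i
    using W by (simp add: orthogonal_matrix_orthonormal_rows)
  have sq: "W$i$1 * W$i$1 + W$i$2 * W$i$2 + W$i$3 * W$i$3 = 1" for i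
    using rows[of i] by (simp add: norm_eq_1 inner_vec_def row_def sum_3)
  \<comment> \<open>On pairs of basis vectors this equates each diagonal cofactor of
    \<open>W\<close> with minus the diagonal entry, as in
    \<open>adj W = det W * transpose W\<close>.\<close>
  have c: "cross3 (W *v x) (W *v y) = - (W *v cross3 x y)" for x y
    using cross_orthogonal_matrix[OF W, of x y] d by simp
  have c3: "W$1$1 * W$2$2 - W$2$1 * W$1$2 = - W$3$3"
    using arg_cong[OF c[of "axis 1 1" "axis 2 1"], of "\<lambda>v. v $ 3"]
    by (simp add: cross3_simps cross3_def matrix_vector_mult_def axis_def sum_3)
  have c1: "W$2$2 * W$3$3 - W$3$2 * W$2$3 = - W$1$1"
    using arg_cong[OF c[of "axis 2 1" "axis 3 1"], of "\<lambda>v. v $ 1"]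
    by (simp add: cross3_simps cross3_def matrix_vector_mult_def axis_def sum_3)
  have c2: "W$3$3 * W$1$1 - W$1$3 * W$3$1 = - W$2$2"
    using arg_cong[OF c[of "axis 3 1" "axis 1 1"], of "\<lambda>v. v $ 2"]
    by (simp add: cross3_simps cross3_def matrix_vector_mult_def axis_def sum_3)
  \<comment> \<open>For a rotation by \<open>\<theta>\<close> this is \<open>(2 + 2 cos \<theta>)\<^sup>2 + 4 sin\<^sup>2 \<theta> = 4 (2 + 2 cos \<theta>)\<close>, applied to \<open>- W\<close>.\<close>
  have "4 * (1 - trace W) = (1 - trace W)\<^sup>2 + (W$1$2 - W$2$1)\<^sup>2 + (W$1$3 - W$3$1)\<^sup>2
      + (W$2$3 - W$3$2)\<^sup>2"
    using sq[of 1] sq[of 2] sq[of 3] c1 c2 c3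
    unfolding trace_def sum_3 power2_eq_square by algebra
  also have "\<dots> \<ge> 0" by simp
  finally show ?thesis using d by simp
qed

lemma trace_mul_diag:
  fixes W :: "real^'n^'n"
  shows "trace (W ** diag d) = (\<Sum>i\<in>UNIV. W $ i $ i * d $ i)"
  by (simp add: trace_def matrix_matrix_mult_def diag_def if_distrib cong: if_cong)

lemma trace_mul_diag_le:
  fixes W :: "real^3^3"
  assumes W: "orthogonal_matrix W" and s: "s$1 \<ge> s$2" "s$2 \<ge> s$3" "s$3 \<ge> 0"
  shows "trace (W ** diag s) \<le> s$1 + s$2 + det W * s$3"
    and "s$2 > s$3 \<Longrightarrow> trace (W ** diag s) = s$1 + s$2 + det W * s$3 \<Longrightarrow>
      W = diag (vector [1, 1, det W])"
proof -
  \<comment> \<open>Splitting off the scalar matrix \<open>s$3 * mat 1\<close> from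
    \<open>diag s\<close> leaves \<open>diag (s$1 - s$3, s$2 - s$3, 0)\<close>. The slack becomes a
    sum of three nonnegative terms, the last one by the trace bound.\<close>
  have eq: "s$1 + s$2 + det W * s$3 - trace (W ** diag s) =
      (s$1 - s$3) * (1 - W$1$1) + (s$2 - s$3) * (1 - W$2$2) + s$3 * (2 + det W - trace W)"
    unfolding trace_mul_diag by (simp add: trace_def sum_3 algebra_simps)
  have le: "W$1$1 \<le> 1" "W$2$2 \<le> 1"
    by (rule orthogonal_matrix_entry_le_1[OF W])+
  have nonneg: "0 \<le> (s$1 - s$3) * (1 - W$1$1)" "0 \<le> (s$2 - s$3) * (1 - W$2$2)"
      "0 \<le> s$3 * (2 + det W - trace W)"
    using le s orthogonal_matrix_trace_le[OF W] by auto
  show "trace (W ** diag s) \<le> s$1 + s$2 + det W * s$3"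
    using eq nonneg by linarith
  assume gap: "s$2 > s$3" and "trace (W ** diag s) = s$1 + s$2 + det W * s$3"
  then have "(s$1 - s$3) * (1 - W$1$1) = 0" "(s$2 - s$3) * (1 - W$2$2) = 0"
    using eq nonneg by linarith+
  \<comment> \<open>The gap makes both coefficients positive, also when \<open>s$3 = 0\<close>. Once
    the off-diagonal entries vanish, the last diagonal entry is the determinant.\<close>
  then have 1: "W$1$1 = 1" "W$2$2 = 1" using gap s by auto
  have "W$1$2 = 0" "W$1$3 = 0" "W$2$1 = 0" "W$3$1 = 0" "W$2$3 = 0" "W$3$2 = 0"
    using orthogonal_matrix_entry_eq_1[OF W 1(1)] orthogonal_matrix_entry_eq_1[OF W 1(2)] by auto
  then show "W = diag (vector [1, 1, det W])"
    using 1 by (simp add: vec_eq_iff forall_3 diag_def det_3)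
qed

section \<open>The rotation of a decomposition as a trace maximizer\<close>

definition rotation_factor :: "real^3^3 \<Rightarrow> real^3^3 \<Rightarrow> real^3^3" where
  "rotation_factor U V = U ** diag (vector [1, 1, sgn (det (U ** transpose V))]) ** transpose V"

lemma transpose_diag [simp]: "transpose (diag d) = diag d"
  by (simp add: transpose_def diag_def vec_eq_iff)

lemma sgn_det_orthogonal:
  fixes U V :: "real^'n^'n"
  assumes "orthogonal_matrix U" "orthogonal_matrix V"
  shows "sgn (det (U ** transpose V)) = det U * det V"
  using det_orthogonal_matrix[OF assms(1)] det_orthogonal_matrix[OF assms(2)]
  by (auto simp: det_mul)

lemma transpose_rotation_factor: "transpose (rotation_factor U V) = rotation_factor V U"
  by (simp add: rotation_factor_def matrix_transpose_mul det_mul matrix_mul_assoc mult.commute)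

text \<open>Stated for right-nested products, the shape produced by
  \<open>matrix_mul_assoc[symmetric]\<close>.\<close>

lemma orthogonal_matrix_cancel:
  fixes U :: "real^'n^'n"
  assumes "orthogonal_matrix U"
  shows "transpose U ** (U ** B) = B" "U ** (transpose U ** B) = B"
  using assms by (simp_all add: orthogonal_matrix_def matrix_mul_assoc)

text \<open>Cyclicity of the trace turns \<open>trace (transpose Q ** A)\<close> into
  \<open>trace (W ** diag s)\<close> with \<open>W = transpose V ** transpose Q ** U\<close>. Since
  \<open>det Q = 1\<close>, the determinant of \<open>W\<close> depends only on \<open>U\<close> and
  \<open>V\<close>, so the bound is the same for all rotations \<open>Q\<close>.\<close>

lemma is_SVD_trace_maximizer:
  assumes svd: "is_SVD A U s V" and Q: "rotation_matrix Q"
  defines "m \<equiv> s$1 + s$2 + det U * det V * s$3"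
  shows "trace (transpose Q ** A) \<le> m"
    and "trace (transpose (rotation_factor U V) ** A) = m"
    and "s$2 > s$3 \<Longrightarrow> trace (transpose Q ** A) = m \<Longrightarrow> Q = rotation_factor U V"
proof -
  have U: "orthogonal_matrix U" and V: "orthogonal_matrix V"
    and s: "s$1 \<ge> s$2" "s$2 \<ge> s$3" "s$3 \<ge> 0" and A: "A = U ** diag s ** transpose V"
    using svd by (auto simp: is_SVD_def)
  have tr: "trace (transpose B ** A) = trace (transpose V ** transpose B ** U ** diag s)" for B
    using trace_mul_sym[of "transpose B ** U ** diag s" "transpose V"]
    by (simp add: A matrix_mul_assoc)
  define W where "W = transpose V ** transpose Q ** U"
  have W: "orthogonal_matrix W" and dW: "det W = det U * det V"
    using U V Q unfolding W_def rotation_matrix_def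
    by (auto intro!: orthogonal_matrix_mul simp: det_mul)
  show "trace (transpose Q ** A) \<le> m"
    using trace_mul_diag_le(1)[OF W s] by (simp add: tr m_def dW W_def[symmetric])
  have "transpose V ** transpose (rotation_factor U V) ** U = diag (vector [1, 1, det U * det V])"
    using U V sgn_det_orthogonal[OF V U]
    by (simp add: transpose_rotation_factor) (simp add: rotation_factor_def
        matrix_mul_assoc[symmetric] orthogonal_matrix_cancel orthogonal_matrix_def mult.commute)
  then show "trace (transpose (rotation_factor U V) ** A) = m"
    by (simp add: tr m_def trace_mul_diag) (simp add: sum_3 diag_def)
  assume "s$2 > s$3" "trace (transpose Q ** A) = m"
  then have "W = diag (vector [1, 1, det U * det V])"
    using trace_mul_diag_le(2)[OF W s] by (simp add: tr m_def dW W_def[symmetric])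
  then have "transpose W = diag (vector [1, 1, det U * det V])" by simp
  \<comment> \<open>This solves the definition of \<open>W\<close> for \<open>Q\<close>.\<close>
  moreover have "Q = U ** transpose W ** transpose V"
    using U V by (simp add: W_def matrix_transpose_mul matrix_mul_assoc[symmetric]
        orthogonal_matrix_cancel orthogonal_matrix_def)
  ultimately show "Q = rotation_factor U V"
    by (simp only: rotation_factor_def sgn_det_orthogonal[OF U V])
qed

text \<open>Unpacks the choice made by \<open>SOME\<close>. The singular values \<open>t\<close> of
  the chosen decomposition are not claimed to equal \<open>s\<close>.\<close>

lemma SVD_proj_rotation_factor:
  assumes "has_singular_values A s"
  obtains U t V where "is_SVD A U t V" "SVD_proj A = rotation_factor U V"
proof -
  have "\<exists>R U t V. is_SVD A U t V \<and> R = rotation_factor U V"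
    using assms unfolding has_singular_values_def by blast
  from someI_ex[OF this[unfolded rotation_factor_def], folded SVD_proj_def rotation_factor_def]
  show ?thesis using that by blast
qed

lemma rotation_matrix_rotation_factor:
  assumes "orthogonal_matrix U" "orthogonal_matrix V"
  shows "rotation_matrix (rotation_factor U V)"
proof -
  define e where "e = det U * det V"
  have e: "e * e = 1" "det U * e * det V = 1"
    using det_orthogonal_matrix[OF assms(1)] det_orthogonal_matrix[OF assms(2)]
    by (auto simp: e_def)
  have "orthogonal_matrix (diag (vector [1, 1, e] :: real^3))"
    using e by (simp add: orthogonal_matrix vec_eq_iff forall_3 diag_def transpose_def
        matrix_matrix_mult_def mat_def sum_3)
  moreover have "det (diag (vector [1, 1, e] :: real^3)) = e"
    by (simp add: diag_def det_3)
  ultimately show ?thesis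
    using assms e unfolding rotation_factor_def sgn_det_orthogonal[OF assms] e_def[symmetric]
    by (auto simp: rotation_matrix_def det_mul intro!: orthogonal_matrix_mul)
qed

lemma SVD_proj_eq:
  assumes svd: "is_SVD A U s V" and gap: "s$2 > s$3"
  shows "SVD_proj A = rotation_factor U V"
proof -
  have sv: "has_singular_values A s"
    using svd by (auto simp: has_singular_values_def)
  obtain U' t V' where svd': "is_SVD A U' t V'" and R: "SVD_proj A = rotation_factor U' V'"
    using SVD_proj_rotation_factor[OF sv] .
  have Q: "rotation_matrix (SVD_proj A)" by (rule rotation_matrix_SVD_proj[OF sv])
  have Q': "rotation_matrix (rotation_factor U V)"
    using svd by (intro rotation_matrix_rotation_factor) (auto simp: is_SVD_def)
  \<comment> \<open>By the chosen decomposition, \<open>SVD_proj A\<close> is a maximizer, so it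
    does at least as well as the competitor \<open>rotation_factor U V\<close>. The given
    decomposition supplies the reverse inequality, and its gap then forces equality of the two
    rotations.\<close>
  have "trace (transpose (rotation_factor U V) ** A) \<le> trace (transpose (SVD_proj A) ** A)"
    using is_SVD_trace_maximizer(1,2)[OF svd' Q'] R by simp
  then show ?thesis
    using is_SVD_trace_maximizer[OF svd Q] gap by force
qed

lemma is_SVD_transpose:
  assumes "is_SVD A U s V"
  shows "is_SVD (transpose A) V s U"
  using assms by (auto simp: is_SVD_def matrix_transpose_mul matrix_mul_assoc)

lemma SVD_proj_transpose:
  assumes "has_singular_values A s" "s$2 > s$3"
  shows "SVD_proj (transpose A) = transpose (SVD_proj A)"
  using assms SVD_proj_eq is_SVD_transpose transpose_rotation_factor
  unfolding has_singular_values_def by metis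

section \<open>Pooling and the swap\<close>

lemma linear_stack_columns: "linear stack_columns"
proof (rule linearI)
  show "stack_columns (A + B) = stack_columns A + stack_columns B" for A B
  proof (rule vec_eq_iff[THEN iffD2], rule allI)
    fix i :: 9
    show "stack_columns (A + B) $ i = (stack_columns A + stack_columns B) $ i"
      using exhaust_9[of i]
      by (elim disjE; hypsubst; simp only: stack_columns_nth vector_add_component)
  qed
  show "stack_columns (c *\<^sub>R A) = c *\<^sub>R stack_columns A" for c A
  proof (rule vec_eq_iff[THEN iffD2], rule allI)
    fix i :: 9
    show "stack_columns (c *\<^sub>R A) $ i = (c *\<^sub>R stack_columns A) $ i"
      using exhaust_9[of i]
      by (elim disjE; hypsubst; simp only: stack_columns_nth vector_scaleR_component)
  qed
qed

lemma linear_transpose: "linear (transpose :: real^'n^'m \<Rightarrow> real^'m^'n)"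
  by (rule linearI) (simp_all add: transpose_def vec_eq_iff)

lemma linear_pool:
  assumes "linear h"
  shows "pool (\<lambda>u. h (g u)) = h (pool g)"
  using assms by (simp add: pool_def linear_sum linear_cmul)

text \<open>As \<open>unvec\<close> is defined as an inverse function, its compatibility with
  averages is transferred from the linearity of \<open>stack_columns\<close>.\<close>

lemma unvec_pool: "unvec (pool g) = pool (\<lambda>u. unvec (g u))"
proof -
  have "stack_columns (pool (\<lambda>u. unvec (g u))) = pool g"
    using linear_pool[OF linear_stack_columns, of "\<lambda>u. unvec (g u)"] by simp
  then show ?thesis by (metis unvec_stack_columns)
qed

lemma r_hat_swap_field: "r_hat (swap_field f) = transpose (r_hat f)"
  by (simp add: r_hat_def swap_field_def unvec_pool linear_pool[OF linear_transpose])

lemma feat10_swap_field: "feat10 (swap_field f) = feat01 f"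
  by (simp add: swap_field_def fun_eq_iff vec_eq_iff column_def transpose_def rowvector_def)

lemma feat01_swap_field: "feat01 (swap_field f) = feat10 f"
  by (simp add: swap_field_def fun_eq_iff vec_eq_iff row_def transpose_def columnvector_def)

theorem proposition5p1:
  fixes f :: "'l::finite tensor_field" and \<sigma> :: "real^3"
  assumes "has_singular_values (r_hat f) \<sigma>"
    and "\<sigma> $ 2 > \<sigma> $ 3"
  shows "Phi_P (swap_field f) = inv\<^bsub>SE3\<^esub> (Phi_P f)"
proof -
  define r where "r = SVD_proj (r_hat f)"
  \<comment> \<open>\<open>a\<close> and \<open>b\<close> are the two means shifted by the pooled
    vector features. The swap exchanges them and transposes \<open>r\<close>.\<close>
  define a where "a = pool (\<lambda>u. fst (point f u)) + pool (feat10 f)"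
  define b where "b = pool (\<lambda>u. snd (point f u)) + pool (feat01 f)"
  have Phi: "Phi_P f = (r, b - r *v a)"
    by (simp add: Phi_P_def Let_def r_def a_def b_def)
  have "Phi_P (swap_field f) = (transpose r, a - transpose r *v b)"
    unfolding Phi_P_def r_hat_swap_field feat10_swap_field feat01_swap_field
      SVD_proj_transpose[OF assms]
    by (simp add: swap_field_def Let_def r_def a_def b_def)
  moreover have "transpose r ** r = mat 1"
    using rotation_matrix_SVD_proj[OF assms(1)]
    by (simp add: r_def rotation_matrix_def orthogonal_matrix_def)
  then have "- (transpose r *v (b - r *v a)) = a - transpose r *v b"
    by (simp add: matrix_vector_mult_diff_distrib matrix_vector_mul_assoc)
  moreover have "(r, b - r *v a) \<in> carrier SE3"
    using Phi_P_in_SE3[OF assms(1)] by (simp add: Phi)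
  ultimately show ?thesis by (simp add: Phi inv_SE3)
qed

end
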